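(* Let $G=(V,\mathcal E,w)$ be an undirected, connected, weighted graph on $n$ nodes with Laplacian $L$ and largest Laplacian eigenvalue $\lambda_n$. Let $\tau\ge0$ with $\tau\lambda_n<\pi/2$. Consider the consensus network with sensor noise $$\dot x(t)=-L\,x(t-\tau)+L\,\xi(t),\qquad y=M_nx,$$ where $\xi_1,\dots,\xi_n$ are mutually independent zero-mean Gaussian white noises with intensities $\sigma_1^2,\dots,\sigma_n^2$. This corresponds to the agent update $$\dot x_i=\sum_{j\ne i}a_{ij}\big((x_j(t-\tau)+\xi_j(t))-(x_i(t-\tau)+\xi_i(t))\big).$$ Then for every agent $i\in V$ the centrality index is $$\eta_i=\frac12\Big[L\cos(\tau L)\big(M_n-\sin(\tau L)\big)^{\dagger}\Big]_{ii}.$$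
   Context: Notation: - $a_{ij}$ are the weighted adjacency entries. - $M_n=I_n-\frac1n\mathbf1\mathbf1^T$. - $X^\dagger$ is the Moore–Penrose pseudo-inverse. - $\cos(X)$ and $\sin(X)$ are the matrix power-series functions. The performance is $$\rho_{ss}=\lim_{t\to\infty}\mathbb E[y^Ty]=\frac1{2\pi}\int_{-\infty}^{\infty}\mathrm{Tr}[G(j\omega)^HG(j\omega)]d\omega,\qquad G(s)=M_n(sI+e^{-\tau s}L)^{-1}L\,\mathrm{diag}(\sigma_1,\dots,\sigma_n).$$ The centrality index is $\eta_i=\partial\rho_{ss}/\partial\sigma_i^2$. *)

theory Defs
  imports "HOL-Analysis.Analysis"
begin

text \<open>Weighted undirected graph on the node type 'n, given by its weighted
adjacency matrix a (a i j = weight of edge {i,j}, 0 if there is no edge).\<close>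

definition weighted_undirected_graph :: "('n::finite \<Rightarrow> 'n \<Rightarrow> real) \<Rightarrow> bool" where
  "weighted_undirected_graph a \<longleftrightarrow>
     (\<forall>i j. a i j \<ge> 0) \<and> (\<forall>i j. a i j = a j i) \<and> (\<forall>i. a i i = 0)"

definition graph_connected :: "('n::finite \<Rightarrow> 'n \<Rightarrow> real) \<Rightarrow> bool" where
  "graph_connected a \<longleftrightarrow> (\<forall>i j. (i, j) \<in> {(u, v). a u v > 0}\<^sup>*)"

definition laplacian :: "('n::finite \<Rightarrow> 'n \<Rightarrow> real) \<Rightarrow> real^'n^'n" where
  "laplacian a = (\<chi> i j. if i = j then (\<Sum>k\<in>UNIV - {i}. a i k) else - a i j)"

text \<open>Largest (real) eigenvalue of a real square matrix.\<close>
definition largest_eigenvalue :: "real^'n^'n \<Rightarrow> real" where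
  "largest_eigenvalue A = Max {e. \<exists>v. v \<noteq> 0 \<and> A *v v = e *\<^sub>R v}"

text \<open>Centering matrix M_n = I - (1/n) 1 1^T.\<close>
definition centering :: "'a::field^'n::finite^'n" where
  "centering = mat 1 - (\<chi> i j. 1 / of_nat CARD('n))"

fun matpow :: "'a::semiring_1^'n::finite^'n \<Rightarrow> nat \<Rightarrow> 'a^'n^'n" where
  "matpow X 0 = mat 1"
| "matpow X (Suc k) = X ** matpow X k"

text \<open>Matrix power-series cosine and sine.\<close>
definition mat_cos :: "real^'n::finite^'n \<Rightarrow> real^'n^'n" where
  "mat_cos X = (\<Sum>k. ((-1) ^ k / fact (2 * k)) *\<^sub>R matpow X (2 * k))"

definition mat_sin :: "real^'n::finite^'n \<Rightarrow> real^'n^'n" where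
  "mat_sin X = (\<Sum>k. ((-1) ^ k / fact (2 * k + 1)) *\<^sub>R matpow X (2 * k + 1))"

text \<open>Moore-Penrose pseudo-inverse (unique matrix satisfying the Penrose equations).\<close>
definition pinv :: "real^'n::finite^'n \<Rightarrow> real^'n^'n" where
  "pinv A = (THE X. A ** X ** A = A \<and> X ** A ** X = X \<and>
                    transpose (A ** X) = A ** X \<and> transpose (X ** A) = X ** A)"

definition conj_transpose :: "complex^'n::finite^'m::finite \<Rightarrow> complex^'m^'n" where
  "conj_transpose A = (\<chi> i j. cnj (A $ j $ i))"

definition cmat :: "real^'n::finite^'m::finite \<Rightarrow> complex^'n^'m" where
  "cmat A = (\<chi> i j. complex_of_real (A $ i $ j))"

text \<open>Transfer function G(s) = M_n (sI + e^{-\<tau> s} L)^{-1} L diag(\<sigma>).\<close>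
definition transfer :: "real^'n::finite^'n \<Rightarrow> real \<Rightarrow> ('n \<Rightarrow> real) \<Rightarrow> complex \<Rightarrow> complex^'n^'n" where
  "transfer L \<tau> \<sigma> s =
     cmat centering ** matrix_inv (\<chi> r c. s * mat 1 $ r $ c + exp (- complex_of_real \<tau> * s) * cmat L $ r $ c)
       ** cmat L ** cmat (\<chi> i j. if i = j then \<sigma> i else 0)"

text \<open>Steady-state performance
  \<rho>_ss = 1/(2\<pi>) \<integral> Tr[G(j\<omega>)^H G(j\<omega>)] d\<omega> (the trace is real).\<close>
definition rho_ss :: "real^'n::finite^'n \<Rightarrow> real \<Rightarrow> ('n \<Rightarrow> real) \<Rightarrow> real" where
  "rho_ss L \<tau> \<sigma> = 1 / (2 * pi) *
     integral UNIV (\<lambda>\<omega>::real. Re (trace (conj_transpose (transfer L \<tau> \<sigma> (\<i> * of_real \<omega>))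
                                          ** transfer L \<tau> \<sigma> (\<i> * of_real \<omega>))))"

end

theory Submission
  imports Defs "HOL-Complex_Analysis.Cauchy_Integral_Formula" "HOL-Real_Asymp.Real_Asymp"
begin

text \<open>
  In an orthonormal eigenbasis of \<open>L\<close> the network decouples into scalar delay systems with
  characteristic functions \<open>h s = s + \<lambda> e\<^bsup>-\<tau>s\<^esup>\<close>, so the performance is the combination, linear in the
  intensities \<open>\<sigma>\<^sub>i\<^sup>2\<close>, of the integrals of \<open>\<lambda>\<^sup>2 / |h (i\<omega>)|\<^sup>2\<close> over the nonzero eigenvalues.

  Each integral comes from the identity \<open>\<lambda> e\<^bsup>-\<tau>s\<^esup> h (-s) + s h s = \<lambda>\<^sup>2 + s\<^sup>2\<close>, which gives
  \<open>1 / |h s|\<^sup>2 = (1 - 2 Re (s / h s)) / (\<lambda>\<^sup>2 + s\<^sup>2)\<close> on the imaginary axis.  Since \<open>\<tau>\<lambda> < \<pi>/2\<close>, \<open>h\<close> has no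
  zeros with \<open>Re s \<ge> 0\<close>.  Subtracting from \<open>s / h s\<close> the affine function \<open>1/2 + d s/\<lambda>\<close> with
  \<open>d = cos (\<tau>\<lambda>) / (2 (1 - sin (\<tau>\<lambda>)))\<close> cancels the poles at \<open>\<plusminus>i\<lambda>\<close>, and as its real part on the axis is
  \<open>1/2\<close> the density becomes \<open>-2 Re\<close> of a function holomorphic for \<open>Re s \<ge> 0\<close>.  Cauchy's theorem on a large half disc leaves only the contribution
  \<open>2\<pi>d/\<lambda>\<close> of the \<open>1/s\<close> tail.
\<close>

section \<open>Spectral theorem for real symmetric matrices\<close>

text \<open>For small \<open>t\<close> the linear term dominates, so a nonzero \<open>p\<close>
  makes the expression positive at some small \<open>t\<close> of the same sign;
  \<open>t = p / r\<close> with \<open>2 * r + q > 0\<close> is small enough. It serves as the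
  first-order condition at a maximum.\<close>

lemma quadratic_nonpos_imp_linear_zero:
  fixes p q :: real
  assumes "\<And>t. 2 * t * p + t\<^sup>2 * q \<le> 0"
  shows "p = 0"
proof (rule ccontr)
  assume "p \<noteq> 0"
  define r where "r = \<bar>q\<bar> + 1"
  have r: "r > 0" "2 * r + q > 0"
    unfolding r_def by (simp_all add: abs_if)
  have "2 * (p / r) * p + (p / r)\<^sup>2 * q = p\<^sup>2 * (2 * r + q) / r\<^sup>2"
    using r by (simp add: field_simps power2_eq_square)
  moreover have "\<dots> > 0"
    using r \<open>p \<noteq> 0\<close> by (intro divide_pos_pos mult_pos_pos) auto
  ultimately show False
    using assms[of "p / r"] by linarith
qed

text \<open>Rayleigh quotient argument: \<open>x \<bullet> f x\<close> attains a maximum on the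
  compact unit sphere of \<open>S\<close>, and the maximiser is an eigenvector whose eigenvalue is
  the maximum.\<close>

lemma self_adjoint_invariant_subspace_eigenvector:
  fixes f :: "'a::euclidean_space \<Rightarrow> 'a"
  assumes lin: "linear f" and sym: "\<And>x y. f x \<bullet> y = x \<bullet> f y"
    and S: "subspace S" "f ` S \<subseteq> S" and ne: "S \<noteq> {0}"
  obtains v e where "v \<in> S" "norm v = 1" "f v = e *\<^sub>R v"
proof -
  interpret linear f by (rule lin)
  obtain x where x: "x \<in> S" "x \<noteq> 0"
    using ne subspace_0[OF S(1)] by blast
  have "compact (sphere 0 1 \<inter> S)"
    by (intro compact_Int_closed closed_subspace S) auto
  moreover have "x /\<^sub>R norm x \<in> sphere 0 1 \<inter> S"
    using x S by (auto simp: subspace_scale)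
  moreover have "continuous_on (sphere 0 1 \<inter> S) (\<lambda>x. x \<bullet> f x)"
    using lin by (intro continuous_on_inner continuous_on_id linear_continuous_on)
      (simp add: linear_conv_bounded_linear)
  ultimately obtain v where v: "v \<in> sphere 0 1 \<inter> S"
    and vmax: "\<And>y. y \<in> sphere 0 1 \<inter> S \<Longrightarrow> y \<bullet> f y \<le> v \<bullet> f v"
    using continuous_attains_sup[of "sphere 0 1 \<inter> S" "\<lambda>x. x \<bullet> f x"] by blast
  define e where "e = v \<bullet> f v"
  have vv: "v \<bullet> v = 1" and vS: "v \<in> S"
    using v by (auto simp: norm_eq_1)
  have le: "y \<bullet> f y - e * (y \<bullet> y) \<le> 0" if "y \<in> S" for y
  proof (cases "y = 0")
    case False
    then have "(y /\<^sub>R norm y) \<bullet> f (y /\<^sub>R norm y) \<le> e"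
      unfolding e_def using that S by (intro vmax) (auto simp: subspace_scale)
    moreover have "(y /\<^sub>R norm y) \<bullet> f (y /\<^sub>R norm y) = (y \<bullet> f y) / (y \<bullet> y)"
      by (simp add: scale divide_inverse dot_square_norm power2_eq_square)
    ultimately show ?thesis
      using False by (simp add: pos_divide_le_eq)
  qed (simp add: zero)
  define w where "w = f v - e *\<^sub>R v"
  have wS: "w \<in> S"
    unfolding w_def using S vS by (auto intro!: subspace_diff subspace_scale)
  \<comment> \<open>The maximiser is perturbed in the direction of its own residual, which stays in
    \<open>S\<close> by invariance. By symmetry of \<open>f\<close> the terms with
    \<open>w \<bullet> v\<close> cancel and the coefficient of \<open>2 * t\<close> is
    \<open>w \<bullet> w\<close>.\<close>
  have "w \<bullet> w = 0"
  proof (rule quadratic_nonpos_imp_linear_zero)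
    fix t :: real
    let ?y = "v + t *\<^sub>R w"
    have "?y \<bullet> f ?y - e * (?y \<bullet> ?y) \<le> 0"
      using S vS wS by (intro le) (auto intro!: subspace_add subspace_scale)
    moreover have "v \<bullet> f w = w \<bullet> f v"
      using sym[of v w] by (simp add: inner_commute)
    moreover have "w \<bullet> f v = w \<bullet> w + e * (w \<bullet> v)"
      by (simp add: w_def algebra_simps)
    moreover have "?y \<bullet> f ?y = e + t * (w \<bullet> f v) + t * (v \<bullet> f w) + t\<^sup>2 * (w \<bullet> f w)"
      by (simp add: add scale inner_add_left inner_add_right e_def power2_eq_square algebra_simps)
    moreover have "?y \<bullet> ?y = 1 + 2 * t * (w \<bullet> v) + t\<^sup>2 * (w \<bullet> w)"
      using vv by (simp add: inner_add_left inner_add_right power2_eq_square inner_commute[of v w] algebra_simps)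
    ultimately have "e + t * (w \<bullet> w + e * (w \<bullet> v)) + t * (w \<bullet> w + e * (w \<bullet> v)) + t\<^sup>2 * (w \<bullet> f w)
        - e * (1 + 2 * t * (w \<bullet> v) + t\<^sup>2 * (w \<bullet> w)) \<le> 0"
      by (simp only:)
    then show "2 * t * (w \<bullet> w) + t\<^sup>2 * (w \<bullet> f w - e * (w \<bullet> w)) \<le> 0"
      by (simp add: algebra_simps)
  qed
  then have "f v = e *\<^sub>R v"
    by (simp add: w_def)
  then show ?thesis
    using v by (intro that[of v e]) auto
qed

text \<open>Induction on the dimension: a unit eigenvector is split off, and self-adjointness keeps
  its orthogonal complement within \<open>S\<close> invariant. Stating the result for all invariant
  subspaces makes the induction hypothesis apply to that complement.\<close>

lemma self_adjoint_orthonormal_eigenbasis_subspace: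
  fixes f :: "'a::euclidean_space \<Rightarrow> 'a"
  assumes lin: "linear f" and sym: "\<And>x y. f x \<bullet> y = x \<bullet> f y"
    and "subspace S" "f ` S \<subseteq> S"
  shows "\<exists>B \<subseteq> S. pairwise orthogonal B \<and> (\<forall>b\<in>B. norm b = 1 \<and> (\<exists>e. f b = e *\<^sub>R b)) \<and> span B = S"
  using assms(3,4)
proof (induction "dim S" arbitrary: S rule: less_induct)
  case less
  interpret linear f by (rule lin)
  show ?case
  proof (cases "S = {0}")
    case True
    then show ?thesis by (intro exI[of _ "{}"]) auto
  next
    case False
    then obtain v e where v: "v \<in> S" "norm v = 1" "f v = e *\<^sub>R v"
      using self_adjoint_invariant_subspace_eigenvector[OF lin sym less.prems] by metis
    have vv: "v \<bullet> v = 1"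
      using v by (simp add: norm_eq_1)
    define T where "T = {x \<in> S. v \<bullet> x = 0}"
    have subT: "subspace T"
      using less.prems(1) unfolding T_def subspace_def by (auto simp: inner_add_right)
    have "T \<subset> S"
      using v(1) vv unfolding T_def by force
    then have "dim T < dim S"
      using subT less.prems(1) by (metis dim_psubset span_eq_iff)
    moreover have "f ` T \<subseteq> T"
      using less.prems(2) by (auto simp: T_def v(3) sym[of v, symmetric])
    ultimately obtain B where B: "B \<subseteq> T" "pairwise orthogonal B"
      "\<forall>b\<in>B. norm b = 1 \<and> (\<exists>e. f b = e *\<^sub>R b)" "span B = T"
      using less.hyps[OF _ subT] by blast
    have "S \<subseteq> span (insert v B)"
    proof
      fix x assume "x \<in> S"
      then have "x - (v \<bullet> x) *\<^sub>R v \<in> T"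
        using v vv less.prems(1) by (auto simp: T_def algebra_simps subspace_diff subspace_scale)
      then show "x \<in> span (insert v B)"
        using B(4) unfolding span_insert by blast
    qed
    moreover have "span (insert v B) \<subseteq> S"
      using v B(1) less.prems(1) by (intro span_minimal) (auto simp: T_def)
    ultimately have "span (insert v B) = S" by auto
    moreover have "pairwise orthogonal (insert v B)"
    proof -
      have "orthogonal v b" "orthogonal b v" if "b \<in> B" for b
        using that B(1) by (auto simp: T_def orthogonal_def inner_commute[of b])
      then show ?thesis
        using B(2) by (simp add: pairwise_insert)
    qed
    moreover have "insert v B \<subseteq> S"
      using B(1) v(1) by (auto simp: T_def)
    moreover have "\<forall>b\<in>insert v B. norm b = 1 \<and> (\<exists>e. f b = e *\<^sub>R b)"
      using B(3) v(2,3) by blast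
    ultimately show ?thesis by blast
  qed
qed

theorem symmetric_matrix_orthonormal_eigenbasis:
  fixes A :: "real^'n::finite^'n"
  assumes "transpose A = A"
  obtains u :: "'n \<Rightarrow> real^'n" and \<mu> :: "'n \<Rightarrow> real"
  where "\<And>j k. u j \<bullet> u k = (if j = k then 1 else 0)" "\<And>k. A *v u k = \<mu> k *\<^sub>R u k"
proof -
  have sym: "(A *v x) \<bullet> y = x \<bullet> (A *v y)" for x y
    using dot_lmul_matrix[of x A y] assms by (metis transpose_matrix_vector)
  obtain B :: "(real^'n) set" where B: "pairwise orthogonal B"
    "\<And>b. b \<in> B \<Longrightarrow> norm b = 1 \<and> (\<exists>e. A *v b = e *\<^sub>R b)" "span B = UNIV"
    using self_adjoint_orthonormal_eigenbasis_subspace[of "(*v) A" UNIV, OF matrix_vector_mul_linear sym]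
    by auto
  have ind: "independent B"
    using B(1,2) by (intro pairwise_orthogonal_independent) fastforce+
  then have fin: "finite B"
    by (rule finiteI_independent)
  have "card B = CARD('n)"
    using dim_eq_card[of B UNIV] ind B(3) by simp
  with fin obtain u where u: "bij_betw u (UNIV :: 'n set) B"
    by (metis finite_same_card_bij finite)
  then have uB: "u k \<in> B" for k
    by (auto simp: bij_betw_def)
  have "\<forall>k. \<exists>e. A *v u k = e *\<^sub>R u k"
    using B(2) uB by blast
  from choice[OF this] obtain \<mu> where "\<And>k. A *v u k = \<mu> k *\<^sub>R u k"
    by blast
  moreover have "u j \<bullet> u k = (if j = k then 1 else 0)" for j k
  proof (cases "j = k")
    case True
    then show ?thesis using B(2)[OF uB[of k]] by (simp add: norm_eq_1)
  next
    case False
    then have "u j \<noteq> u k"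
      using u by (auto simp: bij_betw_def inj_on_def)
    then show ?thesis
      using B(1) uB False by (auto simp: pairwise_def orthogonal_def)
  qed
  ultimately show ?thesis by (rule that[rotated])
qed

section \<open>Functional calculus in a fixed orthonormal basis\<close>

text \<open>For orthonormal \<open>u\<close> this is \<open>U diag(f) U^T\<close> with columns
  \<open>u k\<close>. The entries of \<open>f\<close> are generic so that one calculus covers the
  real Laplacian and the complex resolvent.\<close>

definition spectral_sum :: "('n::finite \<Rightarrow> real^'n) \<Rightarrow> ('n \<Rightarrow> 'a::real_normed_field) \<Rightarrow> 'a^'n^'n" where
  "spectral_sum u f = (\<chi> r c. \<Sum>k\<in>UNIV. f k * of_real (u k $ r * u k $ c))"

lemma spectral_sum_nth: "spectral_sum u f $ r $ c = (\<Sum>k\<in>UNIV. f k * of_real (u k $ r * u k $ c))"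
  by (simp add: spectral_sum_def)

lemma spectral_sum_diff: "spectral_sum u f - spectral_sum u g = spectral_sum u (\<lambda>k. f k - g k)"
  by (simp add: vec_eq_iff spectral_sum_nth sum_subtractf algebra_simps)

lemma scaleR_spectral_sum: "c *\<^sub>R spectral_sum u f = spectral_sum u (\<lambda>k. c *\<^sub>R f k)"
  by (simp add: vec_eq_iff spectral_sum_nth scaleR_sum_right)

lemma transpose_spectral_sum: "transpose (spectral_sum u f) = spectral_sum u f"
  by (simp add: vec_eq_iff transpose_def spectral_sum_nth mult.commute)

lemma cmat_spectral_sum: "cmat (spectral_sum u f) = spectral_sum u (\<lambda>k. of_real (f k))"
  by (simp add: vec_eq_iff cmat_def spectral_sum_nth)

lemma sums_spectral_sum:
  assumes "\<And>k. (\<lambda>n. f n k) sums g k"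
  shows "(\<lambda>n. spectral_sum u (f n)) sums spectral_sum u g"
  unfolding sums_def
proof (intro vec_tendstoI)
  fix r c
  have "(\<lambda>n. \<Sum>k\<in>UNIV. f n k * of_real (u k $ r * u k $ c)) sums (\<Sum>k\<in>UNIV. g k * of_real (u k $ r * u k $ c))"
    by (intro sums_sum sums_mult2 assms)
  then show "(\<lambda>m. (\<Sum>n<m. spectral_sum u (f n)) $ r $ c) \<longlonglongrightarrow> spectral_sum u g $ r $ c"
    by (simp add: sums_def spectral_sum_nth)
qed

lemma matrix_inv_eqI:
  fixes A B :: "'a::field^'n::finite^'n"
  assumes "A ** B = mat 1" "B ** A = mat 1"
  shows "matrix_inv A = B"
proof -
  have "A ** B = mat 1 \<and> B ** A = mat 1"
    using assms by blast
  then have "A ** matrix_inv A = mat 1 \<and> matrix_inv A ** A = mat 1"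
    unfolding matrix_inv_def by (rule someI)
  then show ?thesis
    by (metis assms(2) matrix_mul_assoc matrix_mul_lid matrix_mul_rid)
qed

text \<open>Uniqueness of the Penrose solution: transposing \<open>A X = (A Y)(A X)\<close> gives
  \<open>A X = (A X)(A Y) = A Y\<close>, likewise \<open>X A = Y A\<close>, and then
  \<open>Y = Y A Y = X A X = X\<close>.\<close>

lemma pinv_eqI:
  assumes "A ** X ** A = A" "X ** A ** X = X" "transpose (A ** X) = A ** X" "transpose (X ** A) = X ** A"
  shows "pinv A = X"
  unfolding pinv_def
proof (rule the_equality)
  fix Y
  assume Y: "A ** Y ** A = A \<and> Y ** A ** Y = Y \<and> transpose (A ** Y) = A ** Y \<and> transpose (Y ** A) = Y ** A"
  have AXY: "A ** X = A ** Y"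
  proof -
    have "A ** X = transpose (A ** Y ** (A ** X))"
      using assms Y by (simp add: matrix_mul_assoc)
    also have "\<dots> = A ** X ** (A ** Y)"
      using assms(3) Y by (simp only: matrix_transpose_mul)
    also have "\<dots> = A ** Y"
      using assms by (simp add: matrix_mul_assoc)
    finally show ?thesis .
  qed
  have XAY: "X ** A = Y ** A"
  proof -
    have "X ** A = transpose (X ** A ** (Y ** A))"
      using assms Y by (metis matrix_mul_assoc)
    also have "\<dots> = Y ** A ** (X ** A)"
      using assms(4) Y by (simp only: matrix_transpose_mul)
    also have "\<dots> = Y ** A"
      using assms by (metis matrix_mul_assoc)
    finally show ?thesis .
  qed
  show "Y = X"
    by (metis AXY XAY Y assms(2) matrix_mul_assoc)
qed (use assms in auto)

context
  fixes u :: "'n::finite \<Rightarrow> real^'n"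
  assumes orth: "\<And>j k. u j \<bullet> u k = (if j = k then 1 else 0)"
begin

text \<open>Orthonormality removes the cross terms, so matrix products over a common basis become
  pointwise products of the coefficients.\<close>

lemma spectral_sum_mult: "spectral_sum u f ** spectral_sum u g = spectral_sum u (\<lambda>k. f k * g k :: 'a::real_normed_field)"
proof -
  have "(\<Sum>m\<in>UNIV. (\<Sum>j\<in>UNIV. f j * of_real (u j $ r * u j $ m)) * (\<Sum>k\<in>UNIV. g k * of_real (u k $ m * u k $ c)))
      = (\<Sum>k\<in>UNIV. f k * g k * of_real (u k $ r * u k $ c))" for r c
  proof -
    have "(\<Sum>m\<in>UNIV. (\<Sum>j\<in>UNIV. f j * of_real (u j $ r * u j $ m)) * (\<Sum>k\<in>UNIV. g k * of_real (u k $ m * u k $ c)))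
        = (\<Sum>m\<in>UNIV. \<Sum>j\<in>UNIV. \<Sum>k\<in>UNIV. f j * g k * of_real (u j $ r * u k $ c) * of_real (u j $ m * u k $ m))"
      by (simp add: sum_product mult_ac)
    also have "\<dots> = (\<Sum>j\<in>UNIV. \<Sum>m\<in>UNIV. \<Sum>k\<in>UNIV. f j * g k * of_real (u j $ r * u k $ c) * of_real (u j $ m * u k $ m))"
      by (rule sum.swap)
    also have "\<dots> = (\<Sum>j\<in>UNIV. \<Sum>k\<in>UNIV. \<Sum>m\<in>UNIV. f j * g k * of_real (u j $ r * u k $ c) * of_real (u j $ m * u k $ m))"
      by (intro sum.cong refl sum.swap)
    also have "\<dots> = (\<Sum>j\<in>UNIV. \<Sum>k\<in>UNIV. f j * g k * of_real (u j $ r * u k $ c) * of_real (u j \<bullet> u k))"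
      by (simp only: inner_vec_def inner_real_def of_real_sum sum_distrib_left)
    also have "\<dots> = (\<Sum>j\<in>UNIV. \<Sum>k\<in>UNIV. if j = k then f j * g k * of_real (u j $ r * u k $ c) else 0)"
      by (intro sum.cong refl) (simp add: orth)
    finally show ?thesis by simp
  qed
  then show ?thesis
    by (simp add: vec_eq_iff matrix_matrix_mult_def spectral_sum_nth)
qed

text \<open>Completeness of the basis: orthonormality says \<open>U U^T = 1\<close> for the matrix
  \<open>U\<close> with rows \<open>u k\<close>, and a one-sided inverse of a square matrix is
  two-sided.\<close>

lemma spectral_sum_1_real: "spectral_sum u (\<lambda>k. 1) = (mat 1 :: real^'n^'n)"
proof -
  define U where "U = (\<chi> k c. u k $ c)"
  have "U ** transpose U = mat 1"
    using orth by (simp add: U_def vec_eq_iff matrix_matrix_mult_def transpose_def mat_def inner_vec_def)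
  then have "transpose U ** U = mat 1"
    by (simp add: matrix_left_right_inverse)
  then show ?thesis
    by (simp add: U_def vec_eq_iff matrix_matrix_mult_def transpose_def mat_def spectral_sum_nth)
qed

lemma spectral_sum_1: "spectral_sum u (\<lambda>k. 1) = (mat 1 :: 'a::real_normed_field^'n^'n)"
proof -
  have "of_real (spectral_sum u (\<lambda>k. 1) $ r $ c) = (of_real (mat 1 $ r $ c) :: 'a)" for r c
    by (simp add: spectral_sum_1_real)
  then show ?thesis
    by (simp add: vec_eq_iff spectral_sum_nth mat_def if_distrib cong: if_cong)
qed

lemma spectral_sum_mult_vec: "spectral_sum u f *v u k = f k *\<^sub>R u k"
proof -
  have "(\<Sum>c\<in>UNIV. (\<Sum>j\<in>UNIV. f j * (u j $ r * u j $ c)) * u k $ c)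
      = f k * u k $ r" for r
  proof -
    have "(\<Sum>c\<in>UNIV. (\<Sum>j\<in>UNIV. f j * (u j $ r * u j $ c)) * u k $ c)
        = (\<Sum>c\<in>UNIV. \<Sum>j\<in>UNIV. f j * u j $ r * (u j $ c * u k $ c))"
      by (simp add: sum_distrib_left sum_distrib_right mult_ac)
    also have "\<dots> = (\<Sum>j\<in>UNIV. f j * u j $ r * (u j \<bullet> u k))"
      by (subst sum.swap) (simp add: inner_vec_def sum_distrib_left)
    finally show ?thesis by (simp add: orth if_distrib cong: if_cong)
  qed
  then show ?thesis
    by (simp add: vec_eq_iff matrix_vector_mult_def spectral_sum_nth)
qed

lemma orthonormal_expansion: "x = (\<Sum>k\<in>UNIV. (u k \<bullet> x) *\<^sub>R u k)"
proof -
  have "x $ r = (\<Sum>k\<in>UNIV. (u k \<bullet> x) * u k $ r)" for r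
  proof -
    have "x $ r = (spectral_sum u (\<lambda>k. 1) *v x) $ r"
      by (simp add: spectral_sum_1_real)
    also have "\<dots> = (\<Sum>c\<in>UNIV. \<Sum>k\<in>UNIV. u k $ r * u k $ c * x $ c)"
      by (simp add: matrix_vector_mult_def spectral_sum_nth sum_distrib_right)
    also have "\<dots> = (\<Sum>k\<in>UNIV. (u k \<bullet> x) * u k $ r)"
      by (subst sum.swap) (simp add: inner_vec_def sum_distrib_left sum_distrib_right mult_ac)
    finally show ?thesis .
  qed
  then show ?thesis by (simp add: vec_eq_iff)
qed

lemma eq_spectral_sum_if_eigenvectors:
  assumes "\<And>k. A *v u k = f k *\<^sub>R u k"
  shows "A = spectral_sum u f"
  unfolding matrix_eq
proof
  fix x
  have "A *v (\<Sum>k\<in>UNIV. (u k \<bullet> x) *\<^sub>R u k) = spectral_sum u f *v (\<Sum>k\<in>UNIV. (u k \<bullet> x) *\<^sub>R u k)"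
    by (simp add: linear_sum[OF matrix_vector_mul_linear] matrix_vector_mult_scaleR assms spectral_sum_mult_vec)
  then show "A *v x = spectral_sum u f *v x"
    using orthonormal_expansion[of x] by simp
qed

text \<open>An eigenvector has a nonzero component along some \<open>u k\<close>; pairing the
  eigenvalue equation with that \<open>u k\<close> forces \<open>e = f k\<close>.\<close>

lemma eigenvalues_spectral_sum:
  "{e. \<exists>v. v \<noteq> 0 \<and> spectral_sum u f *v v = e *\<^sub>R v} = range f"
proof (intro equalityI subsetI)
  fix e assume "e \<in> {e. \<exists>v. v \<noteq> 0 \<and> spectral_sum u f *v v = e *\<^sub>R v}"
  then obtain v where v: "v \<noteq> 0" "spectral_sum u f *v v = e *\<^sub>R v" by auto
  then obtain k where k: "u k \<bullet> v \<noteq> 0"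
    using orthonormal_expansion[of v] by fastforce
  have "u k \<bullet> (spectral_sum u f *v v) = (spectral_sum u f *v u k) \<bullet> v"
    by (metis dot_lmul_matrix transpose_spectral_sum transpose_matrix_vector)
  then have "e * (u k \<bullet> v) = f k * (u k \<bullet> v)"
    using v by (simp add: spectral_sum_mult_vec)
  with k show "e \<in> range f" by simp
next
  fix e assume "e \<in> range f"
  then obtain k where "e = f k" by auto
  moreover have "u k \<noteq> 0"
    using orth[of k k] by auto
  ultimately show "e \<in> {e. \<exists>v. v \<noteq> 0 \<and> spectral_sum u f *v v = e *\<^sub>R v}"
    using spectral_sum_mult_vec by blast
qed

lemma matpow_spectral_sum: "matpow (spectral_sum u f) n = spectral_sum u (\<lambda>k. f k ^ n)"
  by (induction n) (simp_all add: spectral_sum_1 spectral_sum_mult)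

lemma mat_cos_spectral_sum: "mat_cos (spectral_sum u f) = spectral_sum u (\<lambda>k. cos (f k))"
  unfolding mat_cos_def matpow_spectral_sum scaleR_spectral_sum real_scaleR_def
  by (intro sums_unique[symmetric] sums_spectral_sum cos_paired)

lemma mat_sin_spectral_sum: "mat_sin (spectral_sum u f) = spectral_sum u (\<lambda>k. sin (f k))"
  unfolding mat_sin_def matpow_spectral_sum scaleR_spectral_sum real_scaleR_def
  by (intro sums_unique[symmetric] sums_spectral_sum sin_paired)

lemma pinv_spectral_sum: "pinv (spectral_sum u f) = spectral_sum u (\<lambda>k. inverse (f k))"
proof (rule pinv_eqI)
  \<comment> \<open>The convention \<open>inverse 0 = 0\<close> is exactly what the pseudo-inverse
    requires on the kernel.\<close>
  have *: "f k * inverse (f k) * f k = f k" "inverse (f k) * f k * inverse (f k) = inverse (f k)" for k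
    by (cases "f k = 0"; simp)+
  show "spectral_sum u f ** spectral_sum u (\<lambda>k. inverse (f k)) ** spectral_sum u f = spectral_sum u f"
    "spectral_sum u (\<lambda>k. inverse (f k)) ** spectral_sum u f ** spectral_sum u (\<lambda>k. inverse (f k)) = spectral_sum u (\<lambda>k. inverse (f k))"
    unfolding spectral_sum_mult * by (rule refl)+
qed (simp_all add: spectral_sum_mult transpose_spectral_sum)

lemma matrix_inv_spectral_sum:
  fixes f :: "'n \<Rightarrow> 'a::real_normed_field"
  assumes "\<And>k. f k \<noteq> 0"
  shows "matrix_inv (spectral_sum u f) = spectral_sum u (\<lambda>k. inverse (f k))"
  using assms by (intro matrix_inv_eqI) (simp_all add: spectral_sum_mult spectral_sum_1)

text \<open>The trace of the Gram matrix is the sum of the squared column norms. The diagonal factor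
  scales column \<open>i\<close> by \<open>s i\<close>, and since the \<open>u k\<close> are real,
  conjugation acts only on the coefficients \<open>g k\<close>.\<close>

lemma trace_gram_spectral_sum_diag:
  fixes g :: "'n \<Rightarrow> complex" and s :: "'n \<Rightarrow> real"
  defines "G \<equiv> spectral_sum u g ** cmat (\<chi> i j. if i = j then s i else 0)"
  shows "Re (trace (conj_transpose G ** G)) = (\<Sum>i\<in>UNIV. (s i)\<^sup>2 * (\<Sum>k\<in>UNIV. (u k $ i)\<^sup>2 * (norm (g k))\<^sup>2))"
proof -
  have G: "G $ r $ i = spectral_sum u g $ r $ i * of_real (s i)" for r i
    by (simp add: G_def matrix_matrix_mult_def cmat_def if_distrib cong: if_cong)
  have col: "(\<Sum>r\<in>UNIV. cnj (spectral_sum u g $ r $ i) * spectral_sum u g $ r $ i)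
      = of_real (\<Sum>k\<in>UNIV. (u k $ i)\<^sup>2 * (norm (g k))\<^sup>2)" for i
  proof -
    have "(\<Sum>r\<in>UNIV. cnj (spectral_sum u g $ r $ i) * spectral_sum u g $ r $ i) = (spectral_sum u (\<lambda>k. cnj (g k)) ** spectral_sum u g) $ i $ i"
      by (simp add: matrix_matrix_mult_def spectral_sum_nth mult_ac)
    also have "\<dots> = of_real (\<Sum>k\<in>UNIV. (u k $ i)\<^sup>2 * (norm (g k))\<^sup>2)"
      unfolding spectral_sum_mult spectral_sum_nth of_real_sum
      by (intro sum.cong refl) (simp add: complex_norm_square[symmetric] power2_eq_square[of "_ $ _"] mult_ac
          flip: of_real_power)
    finally show ?thesis .
  qed
  have "trace (conj_transpose G ** G)
      = (\<Sum>i\<in>UNIV. of_real ((s i)\<^sup>2) * (\<Sum>r\<in>UNIV. cnj (spectral_sum u g $ r $ i) * spectral_sum u g $ r $ i))"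
    by (simp add: trace_def matrix_matrix_mult_def conj_transpose_def G sum_distrib_left power2_eq_square mult_ac)
  then show ?thesis by (simp add: col)
qed

end

section \<open>The frequency integral of a scalar delay system\<close>

text \<open>For a nonnegative integrand the truncations to symmetric intervals increase, so monotone
  convergence turns the principal value into a genuine integral.\<close>

lemma has_integral_UNIV_real_nonneg:
  fixes f :: "real \<Rightarrow> real"
  assumes int: "\<And>n::nat. (f has_integral I n) {- real n..real n}"
    and nonneg: "\<And>x. f x \<ge> 0" and lim: "I \<longlonglongrightarrow> l"
  shows "(f has_integral l) UNIV"
proof (rule has_integral_monotone_convergence_increasing)
  show "((\<lambda>x. if x \<in> {- real n..real n} then f x else 0) has_integral I n) UNIV" for n
    using int[of n] by (simp only: has_integral_restrict_UNIV)
  show "(if x \<in> {- real k..real k} then f x else 0)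
      \<le> (if x \<in> {- real (Suc k)..real (Suc k)} then f x else 0)" for k x
    using nonneg[of x] by auto
  show "(\<lambda>k. if x \<in> {- real k..real k} then f x else 0) \<longlonglongrightarrow> f x" for x
  proof (rule tendsto_eventually, rule eventually_sequentiallyI)
    fix k assume "nat \<lceil>\<bar>x\<bar>\<rceil> \<le> k"
    then have "\<bar>x\<bar> \<le> real k" by linarith
    then show "(if x \<in> {- real k..real k} then f x else 0) = f x" by auto
  qed
qed (rule lim)

text \<open>The segment from \<open>-ir\<close> to \<open>ir\<close> is closed by a half-circle in
  the right half-plane. The loop integral vanishes by Cauchy, and the arc contributes at most
  \<open>\<bar>C\<bar> / r\<^sup>2\<close> times its length \<open>pi * r\<close>.\<close>

lemma integral_imaginary_axis_eq_0:
  fixes f :: "complex \<Rightarrow> complex"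
  assumes hol: "f holomorphic_on {s. Re s \<ge> 0}"
    and bound: "\<And>s. Re s \<ge> 0 \<Longrightarrow> norm s \<ge> r0 \<Longrightarrow> norm (f s) \<le> C / (norm s)\<^sup>2"
  shows "(\<lambda>n::nat. integral {- real n..real n} (\<lambda>w. f (\<i> * of_real w))) \<longlonglongrightarrow> 0"
proof (rule Lim_null_comparison)
  have cont: "continuous_on {s. Re s \<ge> 0} f"
    using hol by (rule holomorphic_on_imp_continuous_on)
  show "(\<lambda>n. \<bar>C\<bar> * pi / real n) \<longlonglongrightarrow> 0"
    by real_asymp
  show "eventually (\<lambda>n. norm (integral {- real n..real n} (\<lambda>w. f (\<i> * of_real w))) \<le> \<bar>C\<bar> * pi / real n) sequentially"
    using eventually_gt_at_top[of "nat \<lceil>\<bar>r0\<bar>\<rceil>"]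
  proof eventually_elim
    case (elim n)
    define r where "r = real n"
    have r: "r > 0" "r \<ge> r0"
      using elim unfolding r_def by linarith+
    define c where "c = part_circlepath 0 r (-pi/2) (pi/2)"
    define l where "l = linepath (\<i> * of_real r) (-\<i> * of_real r)"
    have ends: "pathstart c = -\<i> * of_real r" "pathfinish c = \<i> * of_real r"
      unfolding c_def pathstart_part_circlepath pathfinish_part_circlepath
      using cis_pi_half cis_minus_pi_half by (simp_all add: cis_conv_exp)
    have imc: "Re s \<ge> 0 \<and> norm s = r" if "s \<in> path_image c" for s
    proof -
      from that obtain t where t: "-pi/2 \<le> t" "t \<le> pi/2" "s = of_real r * exp (\<i> * of_real t)"
        unfolding c_def by (subst (asm) path_image_part_circlepath) auto
      then have "cos t \<ge> 0" by (intro cos_ge_zero) auto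
      with t r show ?thesis
        by (simp add: cis_conv_exp[symmetric] norm_mult)
    qed
    have iml: "path_image l \<subseteq> {s. Re s \<ge> 0}"
      unfolding l_def path_image_linepath
      by (intro closed_segment_subset) (auto simp: convex_halfspace_Re_ge)
    have "(f has_contour_integral 0) (c +++ l)"
    proof (rule Cauchy_theorem_convex_simple[OF hol])
      show "convex {s. Re s \<ge> 0}" by (rule convex_halfspace_Re_ge)
      show "valid_path (c +++ l)"
        using ends by (intro valid_path_join) (auto simp: c_def l_def)
      show "path_image (c +++ l) \<subseteq> {s. 0 \<le> Re s}"
        using ends imc iml by (subst path_image_join) (auto simp: l_def)
      show "pathfinish (c +++ l) = pathstart (c +++ l)"
        using ends by (simp add: l_def)
    qed
    moreover have fc: "f contour_integrable_on c"
      unfolding c_def using imc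
      by (intro contour_integrable_continuous_part_circlepath continuous_on_subset[OF cont])
        (auto simp: c_def)
    moreover have fl: "f contour_integrable_on l"
      unfolding l_def
      by (intro contour_integrable_continuous_linepath continuous_on_subset[OF cont])
        (use iml in \<open>simp add: l_def\<close>)
    ultimately have sum0: "contour_integral c f + contour_integral l f = 0"
      using ends by (subst contour_integral_join[symmetric])
        (auto simp: c_def l_def dest: contour_integral_unique)
    have "norm (contour_integral c f) \<le> (\<bar>C\<bar> / r\<^sup>2) * r * \<bar>pi/2 - (-pi/2)\<bar>"
      unfolding c_def
    proof (rule contour_integral_bound_part_circlepath)
      show "norm (f x) \<le> \<bar>C\<bar> / r\<^sup>2" if "x \<in> path_image (part_circlepath 0 r (-pi/2) (pi/2))" for x
      proof -
        have "norm (f x) \<le> C / r\<^sup>2"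
          using bound[of x] imc[of x] that r unfolding c_def by auto
        also have "\<dots> \<le> \<bar>C\<bar> / r\<^sup>2" by (intro divide_right_mono) auto
        finally show ?thesis .
      qed
    qed (use fc r in \<open>auto simp: c_def\<close>)
    also have "\<dots> = \<bar>C\<bar> * pi / r"
      using r by (simp add: field_simps power2_eq_square)
    finally have le: "norm (contour_integral l f) \<le> \<bar>C\<bar> * pi / r"
      using sum0 by (metis add.inverse_unique norm_minus_cancel)
    \<comment> \<open>The path \<open>l\<close> runs down the axis; its reverse is parametrised by
      increasing \<open>w\<close>, and \<open>ds = i dw\<close> accounts for the factor
      \<open>\<i>\<close>.\<close>
    have "(f has_contour_integral - contour_integral l f) (reversepath l)"
      using fl by (intro has_contour_integral_reversepath) (auto simp: l_def has_contour_integral_integral)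
    then have "((\<lambda>w. f (Complex 0 w)) has_integral (-\<i> * - contour_integral l f)) {- r..r}"
      unfolding l_def reversepath_linepath
      using has_contour_integral_linepath_same_Re_iff[of "-\<i> * of_real r" 0 "\<i> * of_real r" "-r" r] r by simp
    then have "integral {- r..r} (\<lambda>w. f (\<i> * of_real w)) = \<i> * contour_integral l f"
      by (intro integral_unique) (simp add: Complex_eq)
    then show ?case
      using le by (simp add: r_def norm_mult)
  qed
qed

text \<open>The quotient has a removable singularity at the zero, filled by the derivative
  there.\<close>

lemma holomorphic_UNIV_factor_zero:
  fixes g :: "complex \<Rightarrow> complex"
  assumes "g holomorphic_on UNIV" "g a = 0"
  obtains f where "f holomorphic_on UNIV" "\<And>z. g z = (z - a) * f z"
proof
  show "(\<lambda>z. if z = a then deriv g a else (g z - g a) / (z - a)) holomorphic_on UNIV"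
    using assms(1) by (intro pole_lemma) auto
  show "g z = (z - a) * (if z = a then deriv g a else (g z - g a) / (z - a))" for z
    using assms(2) by auto
qed

section \<open>Zeros and frequency integral of the scalar delay system\<close>

definition delay_char :: "real \<Rightarrow> real \<Rightarrow> complex \<Rightarrow> complex" where
  "delay_char \<tau> l s = s + of_real l * exp (- of_real \<tau> * s)"

lemma holomorphic_delay_char [holomorphic_intros]: "delay_char \<tau> l holomorphic_on S"
  unfolding delay_char_def[abs_def] by (intro holomorphic_intros)

lemma delay_char_imaginary_axis:
  "delay_char \<tau> l (\<i> * of_real w) = Complex (l * cos (\<tau> * w)) (w - l * sin (\<tau> * w))"
  by (simp add: delay_char_def complex_eq_iff Re_exp Im_exp)

text \<open>In the right half-plane the exponential has modulus at most 1. The bound both localises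
  zeros and controls growth at infinity.\<close>

lemma norm_delay_char_ge:
  assumes "l \<ge> 0" "\<tau> \<ge> 0" "Re s \<ge> 0"
  shows "norm (delay_char \<tau> l s) \<ge> norm s - l"
proof -
  have "norm (of_real l * exp (- of_real \<tau> * s)) \<le> l * 1"
    using assms by (auto simp: norm_mult intro!: mult_left_le)
  then show ?thesis
    unfolding delay_char_def using norm_diff_ineq[of s "of_real l * exp (- of_real \<tau> * s)"] by linarith
qed

text \<open>A zero would have \<open>norm s \<le> l\<close>, hence
  \<open>\<bar>\<tau> * Im s\<bar> < pi / 2\<close>; there the cosine is positive, and so is the
  real part of the characteristic function.\<close>

lemma delay_char_nonzero:
  assumes "l > 0" "\<tau> \<ge> 0" "\<tau> * l < pi / 2" "Re s \<ge> 0"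
  shows "delay_char \<tau> l s \<noteq> 0"
proof
  assume 0: "delay_char \<tau> l s = 0"
  then have "norm s \<le> l"
    using norm_delay_char_ge[of l \<tau> s] assms by simp
  then have "\<tau> * \<bar>Im s\<bar> \<le> \<tau> * l"
    using assms(2) abs_Im_le_cmod[of s] by (intro mult_left_mono) linarith
  then have "\<bar>\<tau> * Im s\<bar> < pi / 2"
    using assms by (simp add: abs_mult)
  then have "cos (\<tau> * Im s) > 0"
    by (intro cos_gt_zero_pi) auto
  then have "Re (delay_char \<tau> l s) > 0"
    using assms by (simp add: delay_char_def Re_exp add_nonneg_pos)
  with 0 show False by simp
qed

lemma has_integral_Lorentzian:
  fixes l b :: real
  assumes "l > 0" "b \<ge> 0"
  shows "((\<lambda>w. l / (w\<^sup>2 + l\<^sup>2)) has_integral 2 * arctan (b / l)) {-b..b}"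
proof -
  have "((\<lambda>w. l / (w\<^sup>2 + l\<^sup>2)) has_integral arctan (b / l) - arctan (-b / l)) {-b..b}"
  proof (rule fundamental_theorem_of_calculus)
    fix w :: real
    have "w\<^sup>2 + l\<^sup>2 > 0" using assms by (simp add: add_nonneg_pos)
    then have "((\<lambda>w. arctan (w / l)) has_real_derivative l / (w\<^sup>2 + l\<^sup>2)) (at w within {-b..b})"
      using assms by (auto intro!: derivative_eq_intros simp: field_simps power2_eq_square)
    then show "((\<lambda>w. arctan (w / l)) has_vector_derivative l / (w\<^sup>2 + l\<^sup>2)) (at w within {-b..b})"
      by (simp add: has_real_derivative_iff_has_vector_derivative)
  qed (use assms in auto)
  then show ?thesis by (simp add: arctan_minus)
qed

theorem has_integral_delay_char:
  assumes l: "l > 0" and \<tau>: "\<tau> \<ge> 0" and small: "\<tau> * l < pi / 2"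
  shows "((\<lambda>w. 1 / (norm (delay_char \<tau> l (\<i> * of_real w)))\<^sup>2) has_integral
          pi * cos (\<tau> * l) / (l * (1 - sin (\<tau> * l)))) UNIV"
proof -
  let ?h = "delay_char \<tau> l"
  have "0 \<le> \<tau> * l" using l \<tau> by simp
  then have "sin (\<tau> * l) < sin (pi / 2)"
    using small by (intro sin_monotone_2pi) auto
  then have sn: "sin (\<tau> * l) < 1" by simp
  \<comment> \<open>This \<open>d\<close> solves \<open>N (il) = 0\<close> for the function
    \<open>N\<close> below: \<open>d1\<close> encodes the real part of the equation and
    \<open>d2\<close> the imaginary part. One unknown satisfies both because
    \<open>cos\<^sup>2 = (1 - sin) (1 + sin)\<close>.\<close>
  define d where "d = cos (\<tau> * l) / (2 * (1 - sin (\<tau> * l)))"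
  have d1: "d * (1 - sin (\<tau> * l)) = cos (\<tau> * l) / 2"
    using sn by (simp add: d_def field_simps)
  have "(cos (\<tau> * l))\<^sup>2 = (1 - sin (\<tau> * l)) * (1 + sin (\<tau> * l))"
    by (simp add: cos_squared_eq power2_eq_square algebra_simps)
  then have "d * cos (\<tau> * l) = (1 + sin (\<tau> * l)) / 2"
    using sn by (simp add: d_def power2_eq_square divide_eq_eq)
  then have d2: "(1 - sin (\<tau> * l)) / 2 + d * cos (\<tau> * l) = 1"
    by (simp add: field_simps)
  have dl: "l * (d * (1 - sin (\<tau> * l))) = l * (cos (\<tau> * l) / 2)"
    "l * ((1 - sin (\<tau> * l)) / 2 + d * cos (\<tau> * l)) = l * 1"
    unfolding d1 d2 by (rule refl)+
  \<comment> \<open>The affine factor agrees with \<open>s / h s\<close> at \<open>\<plusminus>il\<close> and has real part \<open>1/2\<close> on the imaginary axis.\<close>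
  define N where "N = (\<lambda>s. s - ?h s * (1 / 2 + of_real (d / l) * s))"
  have N_hol: "N holomorphic_on UNIV"
    unfolding N_def by (intro holomorphic_intros)
  have N1: "N (\<i> * of_real l) = 0"
    using l dl unfolding N_def delay_char_imaginary_axis
    by (simp add: complex_eq_iff algebra_simps diff_divide_distrib)
  have N2: "N (\<i> * of_real (- l)) = 0"
    using l dl unfolding N_def delay_char_imaginary_axis
    by (simp add: complex_eq_iff algebra_simps diff_divide_distrib)
  obtain N' where N': "N' holomorphic_on UNIV" "\<And>s. N s = (s - \<i> * of_real l) * N' s"
    using holomorphic_UNIV_factor_zero[OF N_hol N1] by blast
  \<comment> \<open>The two zeros are distinct because \<open>l > 0\<close>, so the second one
    survives division by the first factor.\<close>
  have "N' (\<i> * of_real (- l)) = 0"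
    using N2 l by (simp add: N'(2))
  then obtain E where E: "E holomorphic_on UNIV" "\<And>s. N' s = (s - \<i> * of_real (- l)) * E s"
    using holomorphic_UNIV_factor_zero[OF N'(1)] by blast
  have NE: "N s = (s\<^sup>2 + (of_real l)\<^sup>2) * E s" for s
    by (simp add: N'(2) E(2) algebra_simps power2_eq_square)
  \<comment> \<open>The quotient \<open>E s / h s\<close> decays only like
    \<open>- (d / l) / s\<close>. Adding \<open>(d / l) / (s + l)\<close>, whose pole lies in the
    left half-plane, removes this tail and leaves decay of order
    \<open>1 / s\<^sup>2\<close>.\<close>
  define K where "K = (\<lambda>s. E s / ?h s + of_real (d / l) / (s + of_real l))"
  have nz: "?h s \<noteq> 0" if "Re s \<ge> 0" for s
    using delay_char_nonzero[OF l \<tau> small that] .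
  have nz': "s + of_real l \<noteq> 0" if "Re s \<ge> 0" for s
    using that l by (auto simp: complex_eq_iff)
  have K_hol: "K holomorphic_on {s. Re s \<ge> 0}"
    unfolding K_def using nz nz'
    by (intro holomorphic_intros holomorphic_on_subset[OF E(1)]) auto
  \<comment> \<open>Beyond radius \<open>2 * l\<close> one has
    \<open>norm (h s) \<ge> norm s / 2\<close> and
    \<open>norm (s\<^sup>2 + l\<^sup>2) \<ge> (norm s)\<^sup>2 / 2\<close>. The constant is twice
    \<open>2 + 1/2 + 3 * \<bar>d\<bar>\<close>.\<close>
  have K_bound: "norm (K s) \<le> (5 + 6 * \<bar>d\<bar>) / (norm s)\<^sup>2" if s: "Re s \<ge> 0" "norm s \<ge> 2 * l" for s
  proof -
    have "norm (s\<^sup>2 + (of_real l)\<^sup>2) \<ge> (norm s)\<^sup>2 - l\<^sup>2"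
      using norm_diff_ineq[of "s\<^sup>2" "(of_real l)\<^sup>2"] by (simp add: norm_power)
    moreover have "4 * l\<^sup>2 \<le> (norm s)\<^sup>2"
      using power_mono[OF s(2), of 2] l by (simp add: power_mult_distrib)
    ultimately have ge: "norm (s\<^sup>2 + (of_real l)\<^sup>2) \<ge> (norm s)\<^sup>2 / 2"
      using zero_le_power2[of l] by linarith
    have "norm s > 0" using s l by linarith
    then have pos: "(norm s)\<^sup>2 / 2 > 0" by simp
    then have ne: "s\<^sup>2 + (of_real l)\<^sup>2 \<noteq> 0" using ge by auto
    have "norm (?h s) \<ge> norm s / 2"
      using norm_delay_char_ge[of l \<tau> s] l \<tau> s by linarith
    then have b1: "norm (s / ?h s) \<le> 2"
      using nz[OF s(1)] by (simp add: norm_divide divide_le_eq)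
    have "norm (of_real l - s) \<le> l + norm s"
      using norm_triangle_ineq4[of "of_real l" s] l by simp
    moreover have "norm (s + of_real l) \<ge> norm s - l"
      using norm_diff_ineq[of s "of_real l"] l by simp
    ultimately have "norm (of_real l - s) \<le> 3 * norm (s + of_real l)"
      using s by linarith
    then have "norm ((of_real l - s) / (s + of_real l)) \<le> 3"
      using nz'[OF s(1)] by (simp add: norm_divide divide_le_eq)
    then have b2: "norm (of_real d * ((of_real l - s) / (s + of_real l))) \<le> \<bar>d\<bar> * 3"
      unfolding norm_mult by (intro mult_mono) auto
    \<comment> \<open>Over the common denominator the linearly growing terms combine to
      \<open>(s\<^sup>2 + l\<^sup>2) / (s + l) - s = l * (l - s) / (s + l)\<close>, which is
      bounded.\<close>
    have alg: "(A - 1 / 2 - m * s) / q + (m * X) / q = (A - 1 / 2 + m * (X - s)) / q" for A X q m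
      by (simp add: add_divide_distrib diff_divide_distrib algebra_simps)
    have "E s = N s / (s\<^sup>2 + (of_real l)\<^sup>2)"
      using ne by (simp add: NE)
    then have "K s = N s / ?h s / (s\<^sup>2 + (of_real l)\<^sup>2) + of_real (d / l) / (s + of_real l)"
      by (simp add: K_def)
    also have "N s / ?h s = s / ?h s - 1 / 2 - of_real (d / l) * s"
      using nz[OF s(1)] by (simp add: N_def diff_divide_distrib)
    also have "of_real (d / l) / (s + of_real l)
        = (of_real (d / l) * ((s\<^sup>2 + (of_real l)\<^sup>2) / (s + of_real l))) / (s\<^sup>2 + (of_real l)\<^sup>2)"
      using ne by simp
    also have "(s / ?h s - 1 / 2 - of_real (d / l) * s) / (s\<^sup>2 + (of_real l)\<^sup>2) + \<dots>
        = (s / ?h s - 1 / 2 + of_real (d / l) * ((s\<^sup>2 + (of_real l)\<^sup>2) / (s + of_real l) - s)) / (s\<^sup>2 + (of_real l)\<^sup>2)"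
      by (rule alg)
    also have "(s\<^sup>2 + (of_real l)\<^sup>2) / (s + of_real l) - s = of_real l * ((of_real l - s) / (s + of_real l))"
      using nz'[OF s(1)] by (simp add: field_simps power2_eq_square)
    also have "of_real (d / l) * \<dots> = of_real d * ((of_real l - s) / (s + of_real l))"
      using l by simp
    finally have "norm (K s) = norm (s / ?h s - 1 / 2 + of_real d * ((of_real l - s) / (s + of_real l)))
        / norm (s\<^sup>2 + (of_real l)\<^sup>2)"
      by (simp add: norm_divide)
    also have "\<dots> \<le> (5 / 2 + 3 * \<bar>d\<bar>) / norm (s\<^sup>2 + (of_real l)\<^sup>2)"
    proof (intro divide_right_mono)
      have "norm (s / ?h s - 1 / 2 + of_real d * ((of_real l - s) / (s + of_real l)))
          \<le> norm (s / ?h s) + norm (1 / 2 :: complex) + norm (of_real d * ((of_real l - s) / (s + of_real l)))"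
        by (meson add_mono norm_triangle_ineq norm_triangle_ineq4 order_refl order_trans)
      also have "norm (1 / 2 :: complex) = 1 / 2" by (simp add: norm_divide)
      finally show "norm (s / ?h s - 1 / 2 + of_real d * ((of_real l - s) / (s + of_real l))) \<le> 5 / 2 + 3 * \<bar>d\<bar>"
        using b1 b2 by linarith
    qed simp
    also have "\<dots> \<le> (5 / 2 + 3 * \<bar>d\<bar>) / ((norm s)\<^sup>2 / 2)"
      using ge pos by (intro divide_left_mono mult_pos_pos) auto
    finally show ?thesis by (simp add: algebra_simps)
  qed
  \<comment> \<open>The points \<open>\<plusminus>l\<close> are left out because the factor
    \<open>l\<^sup>2 - w\<^sup>2\<close> is cancelled; two points do not affect the
    integral.\<close>
  have density: "1 / (norm (?h (\<i> * of_real w)))\<^sup>2 = - 2 * Re (K (\<i> * of_real w)) + 2 * (d / l) * (l / (w\<^sup>2 + l\<^sup>2))"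
    if w: "w \<noteq> l" "w \<noteq> - l" for w
  proof -
    have w': "l\<^sup>2 - w\<^sup>2 \<noteq> 0"
      using w by (simp add: power2_eq_iff)
    have h0: "?h (\<i> * of_real w) \<noteq> 0" by (rule nz) simp
    define H where "H = (norm (?h (\<i> * of_real w)))\<^sup>2"
    have H: "H = (l * cos (\<tau> * w))\<^sup>2 + (w - l * sin (\<tau> * w))\<^sup>2"
      unfolding H_def delay_char_imaginary_axis by (simp add: cmod_power2)
    have "H = l\<^sup>2 * ((cos (\<tau> * w))\<^sup>2 + (sin (\<tau> * w))\<^sup>2) + w\<^sup>2 - 2 * w * l * sin (\<tau> * w)"
      unfolding H by algebra
    then have H': "H = l\<^sup>2 + w\<^sup>2 - 2 * w * l * sin (\<tau> * w)" by simp
    have Hpos: "H > 0" unfolding H_def using h0 by simp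
    have "Re (\<i> * of_real w / ?h (\<i> * of_real w)) = w * (w - l * sin (\<tau> * w)) / H"
      unfolding H delay_char_imaginary_axis by (simp add: Re_divide)
    moreover have "N (\<i> * of_real w) / ?h (\<i> * of_real w)
        = \<i> * of_real w / ?h (\<i> * of_real w) - (1 / 2 + of_real (d / l) * (\<i> * of_real w))"
      using h0 by (simp add: N_def diff_divide_distrib)
    ultimately have "Re (N (\<i> * of_real w) / ?h (\<i> * of_real w)) = w * (w - l * sin (\<tau> * w)) / H - 1 / 2"
      by simp
    \<comment> \<open>The sine terms cancel: \<open>w * (w - l * sin (\<tau> * w)) - H / 2 =
      (w\<^sup>2 - l\<^sup>2) / 2\<close>.\<close>
    also have "\<dots> = (l\<^sup>2 - w\<^sup>2) * (- 1 / (2 * H))"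
      using Hpos by (simp add: field_simps) (simp add: H' algebra_simps power2_eq_square)
    finally have RN: "Re (N (\<i> * of_real w) / ?h (\<i> * of_real w)) = (l\<^sup>2 - w\<^sup>2) * (- 1 / (2 * H))" .
    have "N (\<i> * of_real w) / ?h (\<i> * of_real w)
        = (l\<^sup>2 - w\<^sup>2) *\<^sub>R (E (\<i> * of_real w) / ?h (\<i> * of_real w))"
      by (simp add: NE power_mult_distrib scaleR_conv_of_real)
    then have "(l\<^sup>2 - w\<^sup>2) * Re (E (\<i> * of_real w) / ?h (\<i> * of_real w)) = (l\<^sup>2 - w\<^sup>2) * (- 1 / (2 * H))"
      using RN by (simp only: scaleR_complex.sel)
    then have "Re (E (\<i> * of_real w) / ?h (\<i> * of_real w)) = - 1 / (2 * H)"
      using w' by (metis mult_left_cancel)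
    moreover have "Re (of_real (d / l) / (\<i> * of_real w + of_real l)) = d / l * (l / (w\<^sup>2 + l\<^sup>2))"
    proof -
      have "of_real (d / l) / (\<i> * of_real w + of_real l) = (d / l) *\<^sub>R (1 / (\<i> * of_real w + of_real l))"
        by (simp add: scaleR_conv_of_real)
      moreover have "Re (1 / (\<i> * of_real w + of_real l)) = l / (w\<^sup>2 + l\<^sup>2)"
        by (simp add: Re_divide add.commute)
      ultimately show ?thesis by (simp only: scaleR_complex.sel)
    qed
    ultimately have "Re (K (\<i> * of_real w)) = - 1 / (2 * H) + d / l * (l / (w\<^sup>2 + l\<^sup>2))"
      by (simp add: K_def)
    then show ?thesis
      unfolding H_def[symmetric] by simp
  qed
  define J where "J = (\<lambda>n::nat. integral {- real n..real n} (\<lambda>w. K (\<i> * of_real w)))"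
  have J_lim: "J \<longlonglongrightarrow> 0"
    unfolding J_def using K_hol K_bound by (rule integral_imaginary_axis_eq_0)
  have cont: "continuous_on S (\<lambda>w. K (\<i> * of_real w))" for S
    by (rule continuous_on_compose2[OF holomorphic_on_imp_continuous_on[OF K_hol]])
      (auto intro!: continuous_intros)
  show ?thesis
  proof (rule has_integral_UNIV_real_nonneg)
    fix n :: nat
    have "((\<lambda>w. K (\<i> * of_real w)) has_integral J n) {- real n..real n}"
      unfolding J_def using integrable_continuous_interval[OF cont] by (rule integrable_integral)
    then have "((\<lambda>w. Re (K (\<i> * of_real w))) has_integral Re (J n)) {- real n..real n}"
      by (rule has_integral_Re)
    then have "((\<lambda>w. - 2 * Re (K (\<i> * of_real w)) + 2 * (d / l) * (l / (w\<^sup>2 + l\<^sup>2))) has_integral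
        - 2 * Re (J n) + 2 * (d / l) * (2 * arctan (real n / l))) {- real n..real n}"
      using has_integral_Lorentzian[OF l, of "real n"]
      by (intro has_integral_add has_integral_mult_right) auto
    then show "((\<lambda>w. 1 / (norm (?h (\<i> * of_real w)))\<^sup>2) has_integral
        - 2 * Re (J n) + 2 * (d / l) * (2 * arctan (real n / l))) {- real n..real n}"
      by (rule has_integral_spike_finite[of "{l, -l}", rotated 2]) (auto simp: density)
  next
    \<comment> \<open>The contour part tends to 0, so the value of the integral is that of the
      Lorentzian part, \<open>2 * pi * d / l\<close>.\<close>
    have "(\<lambda>n. arctan (real n / l)) \<longlonglongrightarrow> pi / 2"
      using l by real_asymp
    then have "(\<lambda>n. - 2 * Re (J n) + 2 * (d / l) * (2 * arctan (real n / l)))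
        \<longlonglongrightarrow> - 2 * Re 0 + 2 * (d / l) * (2 * (pi / 2))"
      by (intro tendsto_intros J_lim)
    also have "- 2 * Re 0 + 2 * (d / l) * (2 * (pi / 2)) = pi * cos (\<tau> * l) / (l * (1 - sin (\<tau> * l)))"
      using l sn by (simp add: d_def field_simps)
    finally show "(\<lambda>n. - 2 * Re (J n) + 2 * (d / l) * (2 * arctan (real n / l)))
        \<longlonglongrightarrow> pi * cos (\<tau> * l) / (l * (1 - sin (\<tau> * l)))" .
  qed simp
qed

section \<open>Graph Laplacians and the performance measure\<close>

text \<open>The Dirichlet form of the graph. On expanding the square, symmetry of the weights makes
  the two diagonal sums equal; the factor 1/2 is due to each edge being counted in both
  directions.\<close>

lemma inner_laplacian:
  assumes "weighted_undirected_graph a"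
  shows "x \<bullet> (laplacian a *v x) = (\<Sum>i\<in>UNIV. \<Sum>j\<in>UNIV. a i j * (x $ i - x $ j)\<^sup>2) / 2"
proof -
  have sym: "a i j = a j i" and diag: "a i i = 0" for i j
    using assms by (auto simp: weighted_undirected_graph_def)
  have L: "laplacian a $ i $ j = (if i = j then \<Sum>k\<in>UNIV. a i k else 0) - a i j" for i j
    using sum.remove[of UNIV i "a i"] by (auto simp: laplacian_def diag)
  let ?S = "\<Sum>i\<in>UNIV. \<Sum>j\<in>UNIV. a i j * (x $ i)\<^sup>2" and ?T = "\<Sum>i\<in>UNIV. \<Sum>j\<in>UNIV. a i j * (x $ i * x $ j)"
  have "(laplacian a *v x) $ i = (\<Sum>j\<in>UNIV. a i j * x $ i) - (\<Sum>j\<in>UNIV. a i j * x $ j)" for i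
    by (simp add: matrix_vector_mult_def L left_diff_distrib sum_subtractf if_distrib[of "\<lambda>y. y * _"]
        sum_distrib_right cong: if_cong)
  then have 1: "x \<bullet> (laplacian a *v x) = ?S - ?T"
    by (simp add: inner_vec_def right_diff_distrib sum_subtractf sum_distrib_left power2_eq_square mult_ac)
  have "(\<Sum>i\<in>UNIV. \<Sum>j\<in>UNIV. a i j * (x $ j)\<^sup>2) = (\<Sum>j\<in>UNIV. \<Sum>i\<in>UNIV. a i j * (x $ j)\<^sup>2)"
    by (rule sum.swap)
  also have "\<dots> = ?S"
    by (intro sum.cong refl) (simp add: sym)
  finally have 2: "(\<Sum>i\<in>UNIV. \<Sum>j\<in>UNIV. a i j * (x $ j)\<^sup>2) = ?S" .
  have "(\<Sum>i\<in>UNIV. \<Sum>j\<in>UNIV. a i j * (x $ i - x $ j)\<^sup>2)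
      = ?S + (\<Sum>i\<in>UNIV. \<Sum>j\<in>UNIV. a i j * (x $ j)\<^sup>2) - 2 * ?T"
    by (simp add: power2_diff algebra_simps sum.distrib sum_subtractf sum_distrib_left)
  then show ?thesis
    unfolding 1 2 by simp
qed

lemma transpose_laplacian:
  assumes "weighted_undirected_graph a"
  shows "transpose (laplacian a) = laplacian a"
  using assms by (auto simp: weighted_undirected_graph_def laplacian_def transpose_def vec_eq_iff)

text \<open>The Dirichlet form vanishes, so each of its nonnegative terms does; \<open>x\<close>
  agrees across every edge and, by induction along paths, everywhere.\<close>

lemma laplacian_kernel_constant:
  assumes "weighted_undirected_graph a" "graph_connected a" "laplacian a *v x = 0"
  shows "x $ i = x $ j"
proof -
  have nn: "a i j \<ge> 0" for i j
    using assms(1) by (auto simp: weighted_undirected_graph_def)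
  have "(\<Sum>i\<in>UNIV. \<Sum>j\<in>UNIV. a i j * (x $ i - x $ j)\<^sup>2) = 0"
    using inner_laplacian[OF assms(1), of x] assms(3) by simp
  then have "a i j * (x $ i - x $ j)\<^sup>2 = 0" for i j
    using nn by (simp add: sum_nonneg_eq_0_iff sum_nonneg)
  then have edge: "x $ i = x $ j" if "a i j > 0" for i j
    using that \<open>\<And>j i. a i j * (x $ i - x $ j)\<^sup>2 = 0\<close>[of i j] by simp
  have "(i, j) \<in> {(u, v). a u v > 0}\<^sup>*"
    using assms(2) by (auto simp: graph_connected_def)
  then show ?thesis
    by (induction rule: rtrancl_induct) (auto dest: edge)
qed

lemma laplacian_mult_one:
  "laplacian a *v 1 = 0"
proof -
  have "(\<Sum>j\<in>UNIV. laplacian a $ i $ j) = 0" for i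
    by (simp add: sum.remove[of UNIV i] laplacian_def sum_negf)
  then show ?thesis
    by (simp add: vec_eq_iff matrix_vector_mult_def)
qed

lemma centering_mult_vec:
  "(centering *v x) $ r = x $ r - (\<Sum>c\<in>UNIV. x $ c) / real CARD('n)" for x :: "real^'n::finite"
proof -
  have "centering *v x = x - (\<chi> i j. 1 / real CARD('n)) *v x"
    by (simp add: centering_def matrix_vector_mult_diff_rdistrib)
  then show ?thesis
    by (simp add: matrix_vector_mult_def sum_divide_distrib)
qed

lemma laplacian_eigenvalue_nonneg:
  assumes "weighted_undirected_graph a" "laplacian a *v x = e *\<^sub>R x" "x \<noteq> 0"
  shows "e \<ge> 0"
proof -
  have "(\<Sum>i\<in>UNIV. \<Sum>j\<in>UNIV. a i j * (x $ i - x $ j)\<^sup>2) \<ge> 0"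
    using assms(1) by (auto simp: weighted_undirected_graph_def intro!: sum_nonneg)
  then have "e * (x \<bullet> x) \<ge> 0"
    using inner_laplacian[OF assms(1), of x] assms(2) by simp
  moreover have "x \<bullet> x > 0"
    using assms(3) by simp
  ultimately show ?thesis
    by (simp add: zero_le_mult_iff)
qed

text \<open>Kernel vectors are constant and are annihilated by centering; the other eigenvectors are
  orthogonal to the constant vector \<open>1\<close> and are fixed. Thus the centering matrix is
  diagonal in any eigenbasis of the Laplacian.\<close>

lemma centering_mult_laplacian_eigenvector:
  fixes a :: "'n::finite \<Rightarrow> 'n \<Rightarrow> real"
  assumes "weighted_undirected_graph a" "graph_connected a" "laplacian a *v x = e *\<^sub>R x"
  shows "centering *v x = (if e = 0 then 0 else 1) *\<^sub>R x"
proof (cases "e = 0")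
  case True
  then have "laplacian a *v x = 0"
    using assms(3) by simp
  then have const: "x $ c = x $ r" for r c
    using laplacian_kernel_constant[OF assms(1,2)] by blast
  have "(centering *v x) $ r = 0" for r
  proof -
    have "(\<Sum>c\<in>UNIV. x $ c) = (\<Sum>c\<in>(UNIV::'n set). x $ r)"
      by (intro sum.cong refl const)
    then show ?thesis
      unfolding centering_mult_vec by simp
  qed
  then show ?thesis
    using True by (simp add: vec_eq_iff)
next
  case False
  have "e * (x \<bullet> 1) = (laplacian a *v x) \<bullet> 1"
    by (simp add: assms(3))
  also have "\<dots> = x \<bullet> (laplacian a *v 1)"
    by (metis dot_lmul_matrix transpose_laplacian[OF assms(1)] transpose_matrix_vector)
  finally have "x \<bullet> 1 = 0"
    using False by (simp add: laplacian_mult_one)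
  then have "(\<Sum>c\<in>UNIV. x $ c) = 0"
    by (simp add: inner_vec_def)
  then show ?thesis
    using False by (simp add: vec_eq_iff centering_mult_vec)
qed

section \<open>Modal form of the performance and its derivative\<close>

text \<open>Centering, resolvent and Laplacian share the eigenbasis, so the transfer function is a
  spectral sum times the diagonal noise matrix, and the performance is linear in the squares of the
  \<open>\<sigma> i\<close>.\<close>

lemma rho_ss_spectral_sum:
  fixes u :: "'n::finite \<Rightarrow> real^'n" and \<mu> \<sigma> :: "'n \<Rightarrow> real"
  assumes orth: "\<And>j k. u j \<bullet> u k = (if j = k then 1 else 0)"
    and centering: "(centering :: real^'n^'n) = spectral_sum u (\<lambda>k. if \<mu> k = 0 then 0 else 1)"
    and nonneg: "\<And>k. \<mu> k \<ge> 0" and \<tau>: "\<tau> \<ge> 0" and small: "\<And>k. \<tau> * \<mu> k < pi / 2"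
  shows "rho_ss (spectral_sum u \<mu>) \<tau> \<sigma> = (\<Sum>i\<in>UNIV. (\<sigma> i)\<^sup>2 *
      (\<Sum>k\<in>UNIV. (u k $ i)\<^sup>2 * (\<mu> k * cos (\<tau> * \<mu> k) / (1 - sin (\<tau> * \<mu> k)) / 2)))"
proof -
  \<comment> \<open>The squared gain of mode \<open>k\<close>. The factor
    \<open>(\<mu> k)\<^sup>2\<close> makes it 0 for the consensus mode at every frequency.\<close>
  define g where "g = (\<lambda>k w. (\<mu> k)\<^sup>2 * (1 / (norm (delay_char \<tau> (\<mu> k) (\<i> * of_real w)))\<^sup>2))"
  have g_int: "(g k has_integral pi * (\<mu> k * cos (\<tau> * \<mu> k) / (1 - sin (\<tau> * \<mu> k)))) UNIV" for k
  proof (cases "\<mu> k = 0")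
    case True
    then show ?thesis by (simp add: g_def)
  next
    case False
    then have "\<mu> k > 0" using nonneg[of k] by simp
    then have "(g k has_integral (\<mu> k)\<^sup>2 * (pi * cos (\<tau> * \<mu> k) / (\<mu> k * (1 - sin (\<tau> * \<mu> k))))) UNIV"
      unfolding g_def using \<tau> small by (intro has_integral_mult_right has_integral_delay_char)
    then show ?thesis
      using False by (simp add: power2_eq_square mult_ac)
  qed
  let ?T = "\<lambda>w. transfer (spectral_sum u \<mu>) \<tau> \<sigma> (\<i> * of_real w)"
  have trace: "Re (trace (conj_transpose (?T w) ** ?T w)) = (\<Sum>i\<in>UNIV. (\<sigma> i)\<^sup>2 * (\<Sum>k\<in>UNIV. (u k $ i)\<^sup>2 * g k w))"
    if w: "w \<noteq> 0" for w :: real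
  proof -
    let ?h = "\<lambda>k. delay_char \<tau> (\<mu> k) (\<i> * of_real w)"
    have h0: "?h k \<noteq> 0" for k
    proof (cases "\<mu> k = 0")
      case False
      then show ?thesis
        using nonneg[of k] small[of k] \<tau> by (intro delay_char_nonzero) auto
    qed (use w in \<open>simp add: delay_char_def\<close>)
    \<comment> \<open>By completeness the identity is itself a spectral sum, so the matrix to be
      inverted is diagonal in the same basis.\<close>
    have "(\<chi> r c. \<i> * of_real w * mat 1 $ r $ c + exp (- of_real \<tau> * (\<i> * of_real w)) * cmat (spectral_sum u \<mu>) $ r $ c)
        = spectral_sum u ?h"
      unfolding spectral_sum_1[OF orth, symmetric] cmat_spectral_sum
      by (simp add: vec_eq_iff spectral_sum_nth sum_distrib_left delay_char_def sum.distrib algebra_simps)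
    then have "?T w = spectral_sum u (\<lambda>k. of_real (if \<mu> k = 0 then 0 else 1) * inverse (?h k) * of_real (\<mu> k))
        ** cmat (\<chi> i j. if i = j then \<sigma> i else 0)"
      unfolding transfer_def centering
      by (simp only: matrix_inv_spectral_sum[OF orth h0] cmat_spectral_sum spectral_sum_mult[OF orth])
    moreover have "(norm (of_real (if \<mu> k = 0 then 0 else 1) * inverse (?h k) * of_real (\<mu> k)))\<^sup>2 = g k w" for k
      by (simp add: g_def norm_mult norm_inverse power_mult_distrib power_inverse divide_inverse)
    ultimately show ?thesis
      by (simp only: trace_gram_spectral_sum_diag[OF orth])
  qed
  have "((\<lambda>w. \<Sum>i\<in>UNIV. (\<sigma> i)\<^sup>2 * (\<Sum>k\<in>UNIV. (u k $ i)\<^sup>2 * g k w)) has_integral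
      (\<Sum>i\<in>UNIV. (\<sigma> i)\<^sup>2 * (\<Sum>k\<in>UNIV. (u k $ i)\<^sup>2 * (pi * (\<mu> k * cos (\<tau> * \<mu> k) / (1 - sin (\<tau> * \<mu> k))))))) UNIV"
    by (intro has_integral_sum has_integral_mult_right g_int) auto
  \<comment> \<open>At frequency \<open>0\<close> the resolvent does not exist, hence the exceptional point.\<close>
  then have "((\<lambda>w. Re (trace (conj_transpose (?T w) ** ?T w))) has_integral
      (\<Sum>i\<in>UNIV. (\<sigma> i)\<^sup>2 * (\<Sum>k\<in>UNIV. (u k $ i)\<^sup>2 * (pi * (\<mu> k * cos (\<tau> * \<mu> k) / (1 - sin (\<tau> * \<mu> k))))))) UNIV"
    by (rule has_integral_spike_finite[of "{0}", rotated 2]) (auto simp: trace)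
  then have "rho_ss (spectral_sum u \<mu>) \<tau> \<sigma> = 1 / (2 * pi) *
      (\<Sum>i\<in>UNIV. (\<sigma> i)\<^sup>2 * (\<Sum>k\<in>UNIV. (u k $ i)\<^sup>2 * (pi * (\<mu> k * cos (\<tau> * \<mu> k) / (1 - sin (\<tau> * \<mu> k))))))"
    unfolding rho_ss_def by (simp only: integral_unique)
  also have "\<dots> = (\<Sum>i\<in>UNIV. (\<sigma> i)\<^sup>2 *
      (\<Sum>k\<in>UNIV. (u k $ i)\<^sup>2 * (\<mu> k * cos (\<tau> * \<mu> k) / (1 - sin (\<tau> * \<mu> k)) / 2)))"
    unfolding sum_distrib_left by (intro sum.cong refl) simp
  finally show ?thesis .
qed

text \<open>The variable is the variance \<open>v\<close>, which enters through the standard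
  deviation \<open>sqrt v\<close>. Variances are nonnegative, so the derivative is taken within
  \<open>{0..}\<close> and is one-sided when \<open>\<sigma> i = 0\<close>.\<close>

theorem theorem5:
  fixes a :: "'n::finite \<Rightarrow> 'n \<Rightarrow> real" and \<tau> :: real and \<sigma> :: "'n \<Rightarrow> real" and i :: 'n
  assumes "weighted_undirected_graph a"
    and "graph_connected a"
    and "\<tau> \<ge> 0"
    and "\<tau> * largest_eigenvalue (laplacian a) < pi / 2"
  shows "((\<lambda>v. rho_ss (laplacian a) \<tau> (\<sigma>(i := sqrt v))) has_real_derivative
           (1/2) * ((laplacian a ** mat_cos (\<tau> *\<^sub>R laplacian a)
                     ** pinv (centering - mat_sin (\<tau> *\<^sub>R laplacian a))) $ i $ i))
         (at ((\<sigma> i)\<^sup>2) within {0..})"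
proof -
  obtain u :: "'n \<Rightarrow> real^'n" and \<mu> :: "'n \<Rightarrow> real"
    where orth: "\<And>j k. u j \<bullet> u k = (if j = k then 1 else 0)"
      and eig: "\<And>k. laplacian a *v u k = \<mu> k *\<^sub>R u k"
    using symmetric_matrix_orthonormal_eigenbasis[OF transpose_laplacian[OF assms(1)]] by blast
  have L: "laplacian a = spectral_sum u \<mu>"
    using orth eig by (rule eq_spectral_sum_if_eigenvectors)
  have M: "(centering :: real^'n^'n) = spectral_sum u (\<lambda>k. if \<mu> k = 0 then 0 else 1)"
    by (intro eq_spectral_sum_if_eigenvectors orth centering_mult_laplacian_eigenvector[OF assms(1,2)] eig)
  have nonneg: "\<mu> k \<ge> 0" for k
    using orth[of k k] by (intro laplacian_eigenvalue_nonneg[OF assms(1) eig[of k]]) auto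
  have small: "\<tau> * \<mu> k < pi / 2" for k
  proof -
    have "\<mu> k \<le> largest_eigenvalue (laplacian a)"
      unfolding largest_eigenvalue_def L eigenvalues_spectral_sum[OF orth] by (intro Max_ge) auto
    then have "\<tau> * \<mu> k \<le> \<tau> * largest_eigenvalue (laplacian a)"
      using assms(3) by (rule mult_left_mono)
    with assms(4) show ?thesis by linarith
  qed
  define C where "C = (\<lambda>i. \<Sum>k\<in>UNIV. (u k $ i)\<^sup>2 * (\<mu> k * cos (\<tau> * \<mu> k) / (1 - sin (\<tau> * \<mu> k)) / 2))"
  have rho: "rho_ss (laplacian a) \<tau> s = (\<Sum>i\<in>UNIV. (s i)\<^sup>2 * C i)" for s
    unfolding L C_def by (rule rho_ss_spectral_sum[OF orth M nonneg assms(3) small])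
  have "(laplacian a ** mat_cos (\<tau> *\<^sub>R laplacian a)
        ** pinv (centering - mat_sin (\<tau> *\<^sub>R laplacian a))) $ i $ i
      = (\<Sum>k\<in>UNIV. \<mu> k * cos (\<tau> * \<mu> k) * inverse ((if \<mu> k = 0 then 0 else 1) - sin (\<tau> * \<mu> k)) * (u k $ i * u k $ i))"
    unfolding L M scaleR_spectral_sum mat_cos_spectral_sum[OF orth] mat_sin_spectral_sum[OF orth] spectral_sum_diff pinv_spectral_sum[OF orth]
      spectral_sum_mult[OF orth]
    by (simp add: spectral_sum_nth)
  \<comment> \<open>The two denominators differ only at zero eigenvalues, where the factor
    \<open>\<mu> k\<close> makes both summands vanish.\<close>
  also have "\<dots> = 2 * C i"
    unfolding C_def sum_distrib_left
  proof (rule sum.cong[OF refl])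
    fix k
    have alg: "x * inverse y * (t * t) = 2 * (t\<^sup>2 * (x / y / 2))" for x y t :: real
      by (cases "y = 0") (simp_all add: field_simps power2_eq_square)
    show "\<mu> k * cos (\<tau> * \<mu> k) * inverse ((if \<mu> k = 0 then 0 else 1) - sin (\<tau> * \<mu> k)) * (u k $ i * u k $ i)
        = 2 * ((u k $ i)\<^sup>2 * (\<mu> k * cos (\<tau> * \<mu> k) / (1 - sin (\<tau> * \<mu> k)) / 2))"
    proof (cases "\<mu> k = 0")
      case False
      then show ?thesis by (simp only: if_False alg)
    qed simp
  qed
  finally have C: "(1/2) * ((laplacian a ** mat_cos (\<tau> *\<^sub>R laplacian a)
        ** pinv (centering - mat_sin (\<tau> *\<^sub>R laplacian a))) $ i $ i) = C i"
    by simp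
  have deriv: "((\<lambda>v. v * C i + (\<Sum>j\<in>UNIV - {i}. (\<sigma> j)\<^sup>2 * C j)) has_real_derivative C i)
      (at ((\<sigma> i)\<^sup>2) within {0..})"
    by (auto intro!: derivative_eq_intros)
  \<comment> \<open>The performance is affine in \<open>v\<close> with slope \<open>C i\<close>; the
    identity \<open>(sqrt v)\<^sup>2 = v\<close> needs \<open>v \<ge> 0\<close>.\<close>
  have affine: "v * C i + (\<Sum>j\<in>UNIV - {i}. (\<sigma> j)\<^sup>2 * C j) = rho_ss (laplacian a) \<tau> (\<sigma>(i := sqrt v))"
    if "v \<in> {0..}" for v
    using that unfolding rho by (subst sum.remove[of UNIV i]) auto
  show ?thesis
    unfolding C by (rule has_field_derivative_transform_within[OF deriv, where d = 1]) (use affine in auto)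
qed

end
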